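(* Consider the constraints of $(AMS_\mu)$. Let $t\in\mathcal{P}$, $t'\ge t$ ($t'\in\mathcal{P}$) and $l\in S_t$ be given, let $K=|S_{t'}\cap\mathcal{T}(l)|$, and order the nodes of $S_{t'}\cap\mathcal{T}(l)$ arbitrarily as $(n,n+1,\dots,n+K-1)$. Then it is sufficient to include the non-anticipativity constraints (C) only for the consecutive node pairs $(n,n+1),(n+1,n+2),\dots,(n+K-2,n+K-1),(n+K-1,n)$ in the form $$x_{im}\ \ge\ x_{im^{+}}-\bar{x}_i\left(r_{it'}-r_{it}\right)\qquad\text{for } m\in S_{t'}\cap\mathcal{T}(l),\ l\in S_t,\ t'\ge t,\ t\in\mathcal{P},\ i\in\mathcal{I},$$ where $m^{+}$ denotes the cyclic successor of $m$ in the chosen ordering of $S_{t'}\cap\mathcal{T}(l)$ (so the successor of the last node $n+K-1$ is the first node $n$). That is, whenever $\mathbf{r}$ satisfies (D) and $0\le x_{in}\le\bar{x}_i$ for all $i,n$, all constraints (C) hold if and only if all the displayed constraints hold.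
   Context: A scenario tree $\mathcal{T}$ has $T$ stages, $\mathcal{P}=\{1,\dots,T\}$; every non-leaf node has $B$ children. $S_t$ is the set of nodes of stage $t$, $P(n)$ is the set of nodes on the path from the root to $n$ (inclusive), and $\mathcal{T}(l)$ is the subtree rooted at node $l$. Node $n$ has probability $p_n$. At each node $n$ there are state variables $\mathbf{x}_n=(x_{1n},\dots,x_{In})$ and stage variables $\mathbf{y}_n$ (integer or continuous); $\mathcal{I}=\{1,\dots,I\}$. Data: $\mathbf{a}_n,\mathbf{b}_n,\mathbf{C}_{nm},\mathbf{D}_n,\mathbf{d}_n$ and local sets $\mathcal{X}_n,\mathcal{Y}_n$. State variables satisfy $0\le x_{in}\le\bar{x}_i$, where $\bar{x}_i$ is a given upper bound; these bounds are implied by $\mathbf{x}_n\in\mathcal{X}_n$. $(AMS_\mu)$, for $\mu\in\{0,\dots,T-1\}$: minimize $\sum_{n\in\mathcal{T}}p_n(\mathbf{a}_n^\top\mathbf{x}_n+\mathbf{b}_n^\top\mathbf{y}_n)$ over $(\mathbf{x},\mathbf{y},\mathbf{r})$ subject to (A) $\sum_{m\in P(n)}\mathbf{C}_{nm}\mathbf{x}_m+\mathbf{D}_n\mathbf{y}_n\ge\mathbf{d}_n$ for all $n\in\mathcal{T}$; (B) $\mathbf{x}_n\in\mathcal{X}_n,\ \mathbf{y}_n\in\mathcal{Y}_n$ for all $n\in\mathcal{T}$; (C) (non-anticipativity constraints) $x_{im}\ge x_{in}-\bar{x}_i(r_{it'}-r_{it})$ and $x_{im}\le x_{in}+\bar{x}_i(r_{it'}-r_{it})$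 for all $m,n\in S_{t'}\cap\mathcal{T}(l)$, $l\in S_t$, $t'\ge t$, $t,t'\in\mathcal{P}$, $i\in\mathcal{I}$; (D) $r_{i1}\le r_{i2}\le\dots\le r_{iT}\le\mu$; $r_{i(t+1)}-r_{it}\le1$ for $t\in\{1,\dots,T-1\}$; $r_{i1}=0$; $r_{it}\in\mathbb{Z}_{+}$, for all $i\in\mathcal{I}$, $t\in\mathcal{P}$. *)

theory Defs
  imports Complex_Main "Jordan_Normal_Form.Matrix"
begin

section \<open>Scenario trees\<close>

text \<open>Arcs point from a node to its children; stages are numbered from 1 (the root) to \<open>stages\<close>.\<close>

record 'n tree_data =
  nodes :: "'n set"
  arcs :: "('n \<times> 'n) set"
  root :: 'n
  stages :: nat
  branching :: nat

definition stage_nodes :: "('n, 'z) tree_data_scheme \<Rightarrow> nat \<Rightarrow> 'n set" where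
  "stage_nodes G t = {n. (root G, n) \<in> arcs G ^^ (t - 1)}"

definition path_nodes :: "('n, 'z) tree_data_scheme \<Rightarrow> 'n \<Rightarrow> 'n set" where
  "path_nodes G n = {m. (m, n) \<in> (arcs G)\<^sup>*}"

definition subtree_nodes :: "('n, 'z) tree_data_scheme \<Rightarrow> 'n \<Rightarrow> 'n set" where
  "subtree_nodes G l = {m. (l, m) \<in> (arcs G)\<^sup>*}"

locale scenario_tree =
  fixes G :: "('n, 'z) tree_data_scheme"
  assumes finite_nodes: "finite (nodes G)"
    and root_node: "root G \<in> nodes G"
    and arcs_subset: "arcs G \<subseteq> nodes G \<times> nodes G"
    and root_no_parent: "\<And>m. (m, root G) \<notin> arcs G"
    and unique_parent: "\<And>n. n \<in> nodes G \<Longrightarrow> n \<noteq> root G \<Longrightarrow> \<exists>!m. (m, n) \<in> arcs G"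
    and reachable: "\<And>n. n \<in> nodes G \<Longrightarrow> (root G, n) \<in> (arcs G)\<^sup>*"
    and stages_pos: "1 \<le> stages G"
    and branching_pos: "1 \<le> branching G"
    and children: "\<And>t n. 1 \<le> t \<Longrightarrow> t < stages G \<Longrightarrow> n \<in> stage_nodes G t
                     \<Longrightarrow> card (arcs G `` {n}) = branching G"
    and leaves: "\<And>n. n \<in> stage_nodes G (stages G) \<Longrightarrow> arcs G `` {n} = {}"

section \<open>Constraints of the adaptive multistage problem\<close>

text \<open>
  State variables are indexed by \<open>{..<num_states}\<close>. The number of constraint rows and of stage
  variables may vary from node to node: they are \<open>dim_vec (rhs M n)\<close> and
  \<open>dim_col (Dmat M n)\<close>. Integrality restrictions are part of the local sets.
\<close>

record 'n ams_data = "'n tree_data" +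
  num_states :: nat
  ub :: "real vec"
  Cmat :: "'n \<Rightarrow> 'n \<Rightarrow> real mat"
  Dmat :: "'n \<Rightarrow> real mat"
  rhs :: "'n \<Rightarrow> real vec"
  Xset :: "'n \<Rightarrow> real vec set"
  Yset :: "'n \<Rightarrow> real vec set"

locale ams_problem = scenario_tree M for M :: "'n ams_data" +
  assumes Cmat_dim: "\<And>n m. n \<in> nodes M \<Longrightarrow> m \<in> path_nodes M n
                       \<Longrightarrow> Cmat M n m \<in> carrier_mat (dim_vec (rhs M n)) (num_states M)"
    and Dmat_dim: "\<And>n. n \<in> nodes M \<Longrightarrow> dim_row (Dmat M n) = dim_vec (rhs M n)"
    and ub_dim: "ub M \<in> carrier_vec (num_states M)"
    and Xset_bounds: "\<And>n v. n \<in> nodes M \<Longrightarrow> v \<in> Xset M n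
                       \<Longrightarrow> v \<in> carrier_vec (num_states M)
                         \<and> (\<forall>i<num_states M. 0 \<le> v $ i \<and> v $ i \<le> ub M $ i)"
    and Yset_dim: "\<And>n. n \<in> nodes M \<Longrightarrow> Yset M n \<subseteq> carrier_vec (dim_col (Dmat M n))"

definition state_bounds :: "'n ams_data \<Rightarrow> ('n \<Rightarrow> real vec) \<Rightarrow> bool" where
  "state_bounds M x \<longleftrightarrow>
     (\<forall>n\<in>nodes M. x n \<in> carrier_vec (num_states M)
        \<and> (\<forall>i<num_states M. 0 \<le> x n $ i \<and> x n $ i \<le> ub M $ i))"

definition linking_constraints ::
  "'n ams_data \<Rightarrow> ('n \<Rightarrow> real vec) \<Rightarrow> ('n \<Rightarrow> real vec) \<Rightarrow> bool" where
  "linking_constraints M x y \<longleftrightarrow>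
     (\<forall>n\<in>nodes M.
        finsum_vec TYPE(real) (dim_vec (rhs M n)) (\<lambda>m. Cmat M n m *\<^sub>v x m) (path_nodes M n)
          + Dmat M n *\<^sub>v y n \<ge> rhs M n)"

definition local_constraints ::
  "'n ams_data \<Rightarrow> ('n \<Rightarrow> real vec) \<Rightarrow> ('n \<Rightarrow> real vec) \<Rightarrow> bool" where
  "local_constraints M x y \<longleftrightarrow> (\<forall>n\<in>nodes M. x n \<in> Xset M n \<and> y n \<in> Yset M n)"

definition revision_constraints :: "'n ams_data \<Rightarrow> nat \<Rightarrow> (nat \<Rightarrow> nat \<Rightarrow> int) \<Rightarrow> bool" where
  "revision_constraints M \<mu> r \<longleftrightarrow>
     (\<forall>i<num_states M.
        (\<forall>t\<in>{1..<stages M}. r i t \<le> r i (t + 1)) \<and> r i (stages M) \<le> int \<mu>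
      \<and> (\<forall>t\<in>{1..<stages M}. r i (t + 1) - r i t \<le> 1)
      \<and> r i 1 = 0
      \<and> (\<forall>t\<in>{1..stages M}. 0 \<le> r i t))"

subsection \<open>Non-anticipativity\<close>

definition group_nodes :: "'n ams_data \<Rightarrow> nat \<Rightarrow> 'n \<Rightarrow> 'n set" where
  "group_nodes M t' l = stage_nodes M t' \<inter> subtree_nodes M l"

definition group_nac ::
  "'n ams_data \<Rightarrow> ('n \<Rightarrow> real vec) \<Rightarrow> (nat \<Rightarrow> nat \<Rightarrow> int) \<Rightarrow> nat \<Rightarrow> nat \<Rightarrow> 'n \<Rightarrow> bool" where
  "group_nac M x r t t' l \<longleftrightarrow>
     (\<forall>i<num_states M. \<forall>m\<in>group_nodes M t' l. \<forall>n\<in>group_nodes M t' l.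
        x m $ i \<ge> x n $ i - ub M $ i * real_of_int (r i t' - r i t)
      \<and> x m $ i \<le> x n $ i + ub M $ i * real_of_int (r i t' - r i t))"

text \<open>The list \<open>ns\<close> is the chosen ordering of the group; positions are taken modulo its length,
  so that the successor of the last node is the first one.\<close>

definition cyclic_group_nac ::
  "'n ams_data \<Rightarrow> ('n \<Rightarrow> real vec) \<Rightarrow> (nat \<Rightarrow> nat \<Rightarrow> int) \<Rightarrow> nat \<Rightarrow> nat \<Rightarrow> 'n list \<Rightarrow> bool" where
  "cyclic_group_nac M x r t t' ns \<longleftrightarrow>
     (\<forall>i<num_states M. \<forall>k<length ns.
        x (ns ! k) $ i \<ge> x (ns ! ((k + 1) mod length ns)) $ i
                          - ub M $ i * real_of_int (r i t' - r i t))"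

definition nac :: "'n ams_data \<Rightarrow> ('n \<Rightarrow> real vec) \<Rightarrow> (nat \<Rightarrow> nat \<Rightarrow> int) \<Rightarrow> bool" where
  "nac M x r \<longleftrightarrow>
     (\<forall>t\<in>{1..stages M}. \<forall>t'\<in>{t..stages M}. \<forall>l\<in>stage_nodes M t. group_nac M x r t t' l)"

definition cyclic_nac ::
  "'n ams_data \<Rightarrow> (nat \<Rightarrow> nat \<Rightarrow> 'n \<Rightarrow> 'n list) \<Rightarrow> ('n \<Rightarrow> real vec) \<Rightarrow> (nat \<Rightarrow> nat \<Rightarrow> int) \<Rightarrow> bool"
  where
  "cyclic_nac M ns x r \<longleftrightarrow>
     (\<forall>t\<in>{1..stages M}. \<forall>t'\<in>{t..stages M}. \<forall>l\<in>stage_nodes M t.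
        cyclic_group_nac M x r t t' (ns t t' l))"

definition group_orderings :: "'n ams_data \<Rightarrow> (nat \<Rightarrow> nat \<Rightarrow> 'n \<Rightarrow> 'n list) \<Rightarrow> bool" where
  "group_orderings M ns \<longleftrightarrow>
     (\<forall>t\<in>{1..stages M}. \<forall>t'\<in>{t..stages M}. \<forall>l\<in>stage_nodes M t.
        distinct (ns t t' l) \<and> set (ns t t' l) = group_nodes M t' l)"

subsection \<open>Feasible regions\<close>

definition feasible ::
  "'n ams_data \<Rightarrow> nat \<Rightarrow> (('n \<Rightarrow> real vec) \<times> ('n \<Rightarrow> real vec) \<times> (nat \<Rightarrow> nat \<Rightarrow> int)) set" where
  "feasible M \<mu> = {(x, y, r). linking_constraints M x y \<and> local_constraints M x y
                     \<and> nac M x r \<and> revision_constraints M \<mu> r}"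

definition feasible_cyclic ::
  "'n ams_data \<Rightarrow> nat \<Rightarrow> (nat \<Rightarrow> nat \<Rightarrow> 'n \<Rightarrow> 'n list)
     \<Rightarrow> (('n \<Rightarrow> real vec) \<times> ('n \<Rightarrow> real vec) \<times> (nat \<Rightarrow> nat \<Rightarrow> int)) set" where
  "feasible_cyclic M \<mu> ns = {(x, y, r). linking_constraints M x y \<and> local_constraints M x y
                               \<and> cyclic_nac M ns x r \<and> revision_constraints M \<mu> r}"

end

(* In a group, the number of revisions between stages t and t' is a nonnegative integer d.
   If d \<ge> 1, both families of constraints follow from the bounds on the state variables. If d = 0,
   the cyclic constraints say that the states are nonincreasing along a cycle, hence constant. *)

theory Submission
  imports Defs
begin

text \<open>Going once around the cycle gives
  \<open>f 0 \<le> f (n - 1) \<le> ... \<le> f a \<le> ... \<le> f 0\<close>, so antisymmetry makes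
  all these values equal.\<close>

lemma cyclic_nonincreasing_imp_const:
  fixes f :: "nat \<Rightarrow> 'a::order"
  assumes step: "\<And>k. k < n \<Longrightarrow> f ((k + 1) mod n) \<le> f k"
    and "j < n" "k < n"
  shows "f j = f k"
proof -
  have mono: "f b \<le> f a" if "a \<le> b" "b < n" for a b
    using that
  proof (induction b rule: dec_induct)
    case (step c)
    have "f (Suc c) \<le> f c"
      using assms(1)[of c] step.prems by simp
    also have "\<dots> \<le> f a"
      using step.IH step.prems by simp
    finally show ?case .
  qed simp
  \<comment> \<open>The closing step of the cycle: at \<open>k = n - 1\<close> the successor index
    is \<open>n mod n = 0\<close>. The bound \<open>j < n\<close> ensures that \<open>n\<close> is
    positive.\<close>
  have wrap: "f 0 \<le> f (n - 1)"
    using step[of "n - 1"] \<open>j < n\<close> by simp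
  have const: "f a = f 0" if "a < n" for a
  proof (rule order.antisym)
    show "f a \<le> f 0" using mono[of 0 a] that by simp
    have "a \<le> n - 1" "n - 1 < n" using that by linarith+
    then have "f (n - 1) \<le> f a" by (rule mono)
    with wrap show "f 0 \<le> f a" by (rule order_trans)
  qed
  show ?thesis
    using const[OF assms(2)] const[OF assms(3)] by metis
qed

lemma (in scenario_tree) stage_nodes_subset: "stage_nodes G t \<subseteq> nodes G"
proof
  fix n
  assume "n \<in> stage_nodes G t"
  then have "(root G, n) \<in> (arcs G)\<^sup>*"
    unfolding stage_nodes_def using relpow_imp_rtrancl by fast
  then show "n \<in> nodes G"
  proof (cases rule: rtranclE)
    case base
    with root_node show ?thesis by simp
  next
    case (step m)
    with arcs_subset show ?thesis by blast
  qed
qed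

text \<open>Chaining the one-stage inequalities makes the number of revisions between two stages
  nonnegative.\<close>

lemma revision_constraints_mono:
  assumes "revision_constraints M \<mu> r" "i < num_states M"
    and "1 \<le> t" "t \<le> t'" "t' \<le> stages M"
  shows "r i t \<le> r i t'"
  using assms(4,5)
proof (induction t' rule: dec_induct)
  case (step s)
  then have "s \<in> {1..<stages M}"
    using assms(3) by simp
  then have "r i s \<le> r i (s + 1)"
    using assms(1,2) unfolding revision_constraints_def by blast
  moreover have "r i t \<le> r i s"
    using step.IH step.prems by linarith
  ultimately show ?case by simp
qed simp

text \<open>The feasible regions do not list the bounds explicitly; they are recovered from the
  local sets \<open>Xset\<close>.\<close>

lemma local_constraints_imp_state_bounds:
  assumes "ams_problem M" "local_constraints M x y"
  shows "state_bounds M x"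
  using assms(2) ams_problem.Xset_bounds[OF assms(1)]
  unfolding local_constraints_def state_bounds_def by simp

text \<open>The equivalence already holds for each single group, with \<open>t\<close>,
  \<open>t'\<close> and \<open>l\<close> fixed.\<close>

lemma group_nac_iff_cyclic_group_nac:
  assumes rev: "\<And>i. i < num_states M \<Longrightarrow> r i t \<le> r i t'"
    and sb: "state_bounds M x"
    and sub: "group_nodes M t' l \<subseteq> nodes M"
    and ns: "set ns = group_nodes M t' l"
  shows "group_nac M x r t t' l \<longleftrightarrow> cyclic_group_nac M x r t t' ns"
proof
  assume nac: "group_nac M x r t t' l"
  show "cyclic_group_nac M x r t t' ns"
    unfolding cyclic_group_nac_def
  proof (intro allI impI)
    fix i k
    assume "i < num_states M" and k: "k < length ns"
    \<comment> \<open>Each cyclic constraint is the lower-bound half of a pairwise one, taken at a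
      node and its successor.\<close>
    moreover have "ns ! k \<in> group_nodes M t' l" "ns ! ((k + 1) mod length ns) \<in> group_nodes M t' l"
      using k unfolding ns[symmetric] by (auto intro!: nth_mem mod_less_divisor)
    ultimately show "x (ns ! k) $ i
        \<ge> x (ns ! ((k + 1) mod length ns)) $ i - ub M $ i * real_of_int (r i t' - r i t)"
      using nac unfolding group_nac_def by blast
  qed
next
  assume cyc: "cyclic_group_nac M x r t t' ns"
  show "group_nac M x r t t' l"
    unfolding group_nac_def
  proof (intro allI impI ballI)
    fix i m n
    assume i: "i < num_states M" and mn: "m \<in> group_nodes M t' l" "n \<in> group_nodes M t' l"
    let ?d = "r i t' - r i t"
    show "x m $ i \<ge> x n $ i - ub M $ i * real_of_int ?d
        \<and> x m $ i \<le> x n $ i + ub M $ i * real_of_int ?d"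
    proof (cases "?d = 0")
      case True
      obtain j k where jk: "j < length ns" "m = ns ! j" "k < length ns" "n = ns ! k"
        using mn unfolding ns[symmetric] in_set_conv_nth by blast
      have "x (ns ! ((a + 1) mod length ns)) $ i \<le> x (ns ! a) $ i" if "a < length ns" for a
        using cyc i that True unfolding cyclic_group_nac_def by force
      then have "x m $ i = x n $ i"
        using cyclic_nonincreasing_imp_const[of "length ns" "\<lambda>a. x (ns ! a) $ i" j k] jk by simp
      then show ?thesis using True by simp
    next
      case False
      have bounds: "0 \<le> x m $ i" "x m $ i \<le> ub M $ i" "0 \<le> x n $ i" "x n $ i \<le> ub M $ i"
        using sb i mn sub unfolding state_bounds_def by blast+
      \<comment> \<open>Integrality of \<open>r\<close> enters here: a nonzero nonnegative integer
        is at least 1.\<close>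
      have "1 \<le> ?d" using False rev[OF i] by linarith
      \<comment> \<open>The slack is thus at least \<open>ub M $ i\<close>, the largest possible gap
        between two states in their range. The sign of \<open>ub M $ i\<close> needed here follows
        from the bounds on \<open>x m $ i\<close>.\<close>
      then have "ub M $ i * 1 \<le> ub M $ i * real_of_int ?d"
        using bounds by (intro mult_left_mono) linarith+
      then show ?thesis using bounds by linarith
    qed
  qed
qed

theorem proposition5:
  fixes M :: "'n ams_data" and \<mu> :: nat and ns :: "nat \<Rightarrow> nat \<Rightarrow> 'n \<Rightarrow> 'n list"
  assumes "ams_problem M"
    and "\<mu> \<in> {0..stages M - 1}"
    and "group_orderings M ns"
  shows "(\<forall>x r. revision_constraints M \<mu> r \<and> state_bounds M x \<longrightarrow>
            (\<forall>t\<in>{1..stages M}. \<forall>t'\<in>{t..stages M}. \<forall>l\<in>stage_nodes M t.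
               group_nac M x r t t' l \<longleftrightarrow> cyclic_group_nac M x r t t' (ns t t' l))
          \<and> (nac M x r \<longleftrightarrow> cyclic_nac M ns x r))
       \<and> feasible M \<mu> = feasible_cyclic M \<mu> ns"
proof -
  interpret ams_problem M by fact
  have group: "group_nac M x r t t' l \<longleftrightarrow> cyclic_group_nac M x r t t' (ns t t' l)"
    if "revision_constraints M \<mu> r" "state_bounds M x"
      "t \<in> {1..stages M}" "t' \<in> {t..stages M}" "l \<in> stage_nodes M t" for x r t t' l
  proof (rule group_nac_iff_cyclic_group_nac)
    show "r i t \<le> r i t'" if "i < num_states M" for i
      using revision_constraints_mono[OF \<open>revision_constraints M \<mu> r\<close> that] \<open>t \<in> _\<close> \<open>t' \<in> _\<close>
      by simp
    show "group_nodes M t' l \<subseteq> nodes M"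
      unfolding group_nodes_def using stage_nodes_subset by blast
    show "set (ns t t' l) = group_nodes M t' l"
      using assms(3) that unfolding group_orderings_def by blast
  qed fact
  then have all: "nac M x r \<longleftrightarrow> cyclic_nac M ns x r"
    if "revision_constraints M \<mu> r" "state_bounds M x" for x r
    using that unfolding nac_def cyclic_nac_def by simp
  \<comment> \<open>Both regions contain the local and the revision constraints, so the hypotheses
    of \<open>all\<close> are available in either direction.\<close>
  have "(x, y, r) \<in> feasible M \<mu> \<longleftrightarrow> (x, y, r) \<in> feasible_cyclic M \<mu> ns" for x y r
    using all[of r x] local_constraints_imp_state_bounds[OF assms(1), of x y]
    unfolding feasible_def feasible_cyclic_def by auto
  then have "feasible M \<mu> = feasible_cyclic M \<mu> ns" by auto
  with group all show ?thesis by simp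
qed

end
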